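(* Let $q$ be a prime power with $q\equiv 1 \pmod 4$. The graph $H_q$ has a short spanning factorization.
   Context: Definition of $H_q$. Let $F=GF(q)$, let $z$ be a primitive root of $GF(q)$ (a generator of its multiplicative group), and let $X=\{z^{2k}\}$ be the set of all even powers of $z$. The vertices of $H_q$ are the triples $(i,m,r)$ with $i,m\in F$ and $r\in\mathbb{Z}_2=\{0,1\}$ (so there are $2q^2$ vertices). There are directed edges from $(i,m,r)$ to each of the $(q-1)/2$ vertices $(i,m+z^rx,r)$ with $x\in X$, and to each of the $q$ vertices $(j,m+(-1)^rij,1-r)$ with $j\in F$. The in-degree and out-degree of $H_q$ are $d=(3q-1)/2$ and its diameter is 2. A 1-factor of a directed graph $G$ is a (spanning) subgraph in which every vertex has in-degree and out-degree equal to 1. A 1-factoring of a directed graph with all in-degrees and out-degrees equal to $d$ is a decomposition of its edge set into $d$ edge-disjoint 1-factors $F_1,\dots,F_d$. A word is a finite string of symbols from $\{F_1,\dots,F_d\}$. If $v$ is a vertex and $\omega$ is a word, $v\omega$ denotes the directed path (and also its endpoint) starting at $v$ and following successively, for each consecutive symbol of $\omega$, the unique edge of that factor leaving the current vertex. If $G$ has $n$ vertices, a 1-factoring together with a set of $n$ words $W=\{\omega_0,\omega_1,\dots,\omega_{n-1}\}$ with $\omega_0=\emptyset$ is a spanning factorization of $G$ (with word list $W$) if for every vertex $v$ the vertices $v\omega_0,\dots,v\omega_{n-1}$ are distinct. Let $|\{F_i:F_i\in W\}|$ denote the total number of occurrences (with multiplicity) of the symbol $F_i$ in the words of $W$. Let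 $N_k$ be the number of ordered pairs $(u,w)$ of vertices such that the directed distance from $u$ to $w$ is $k$, and let $D$ be the diameter of $G$. A spanning factorization is short if $$\left\lceil \sum_{i=1}^{d} |\{F_i : F_i \in W\}| / d \right\rceil = \left\lceil \sum_{k=1}^{D} \frac{kN_k}{nd} \right\rceil .$$ *)

theory Defs
  imports
    "Graph_Theory.Pair_Digraph"
    "Graph_Theory.Digraph_Component"
    "Graph_Theory.Shortest_Path"
    "HOL-Library.Cardinality"
    "HOL-Library.Disjoint_Sets"
    "HOL-Number_Theory.Number_Theory"
begin

section \<open>Factorizations of regular directed graphs\<close>

definition regular_digraph :: "('v, 'e) pre_digraph \<Rightarrow> nat \<Rightarrow> bool" where
  "regular_digraph G d \<longleftrightarrow> fin_digraph G \<and>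
     (\<forall>v\<in>verts G. in_degree G v = d \<and> out_degree G v = d)"

definition one_factor :: "('v, 'e) pre_digraph \<Rightarrow> ('v, 'e) pre_digraph \<Rightarrow> bool" where
  "one_factor H G \<longleftrightarrow> spanning H G \<and>
     (\<forall>v\<in>verts G. in_degree H v = 1 \<and> out_degree H v = 1)"

definition one_factoring ::
    "('v, 'e) pre_digraph \<Rightarrow> nat \<Rightarrow> (nat \<Rightarrow> ('v, 'e) pre_digraph) \<Rightarrow> bool" where
  "one_factoring G d F \<longleftrightarrow>
     regular_digraph G d \<and>
     (\<forall>i\<in>{1..d}. one_factor (F i) G) \<and>
     disjoint_family_on (\<lambda>i. arcs (F i)) {1..d} \<and>
     (\<Union>i\<in>{1..d}. arcs (F i)) = arcs G"

definition factor_succ :: "('v, 'e) pre_digraph \<Rightarrow> 'v \<Rightarrow> 'v" where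
  "factor_succ H v = head H (THE e. e \<in> out_arcs H v)"

text \<open>
  A word is a list of indices \<open>i \<in> {1..d}\<close>, where \<open>i\<close> stands for the symbol \<open>F i\<close>;
  \<open>word_end F v w\<close> is the endpoint of the path that starts at \<open>v\<close> and follows \<open>w\<close>.
\<close>

definition word_end :: "(nat \<Rightarrow> ('v, 'e) pre_digraph) \<Rightarrow> 'v \<Rightarrow> nat list \<Rightarrow> 'v" where
  "word_end F v w = foldl (\<lambda>u i. factor_succ (F i) u) v w"

text \<open>The word list consists of \<open>W 0, \<dots>, W (n - 1)\<close>, where \<open>n\<close> is the number of vertices.\<close>

definition spanning_factorization ::
    "('v, 'e) pre_digraph \<Rightarrow> nat \<Rightarrow> (nat \<Rightarrow> ('v, 'e) pre_digraph) \<Rightarrow> (nat \<Rightarrow> nat list) \<Rightarrow> bool" where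
  "spanning_factorization G d F W \<longleftrightarrow>
     one_factoring G d F \<and>
     (\<forall>k<card (verts G). set (W k) \<subseteq> {1..d}) \<and>
     W 0 = [] \<and>
     (\<forall>v\<in>verts G. inj_on (\<lambda>k. word_end F v (W k)) {..<card (verts G)})"

definition directed_dist :: "('v, 'e) pre_digraph \<Rightarrow> 'v \<Rightarrow> 'v \<Rightarrow> ereal" where
  "directed_dist G u w = wf_digraph.\<mu> G (\<lambda>_. 1) u w"

definition digraph_diameter :: "('v, 'e) pre_digraph \<Rightarrow> ereal" where
  "digraph_diameter G = (SUP u\<in>verts G. SUP w\<in>verts G. directed_dist G u w)"

definition num_pairs_at_dist :: "('v, 'e) pre_digraph \<Rightarrow> nat \<Rightarrow> nat" where
  "num_pairs_at_dist G k =
     card {(u, w). u \<in> verts G \<and> w \<in> verts G \<and> directed_dist G u w = ereal (real k)}"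

definition symbol_occurrences :: "('v, 'e) pre_digraph \<Rightarrow> (nat \<Rightarrow> nat list) \<Rightarrow> nat \<Rightarrow> nat" where
  "symbol_occurrences G W i = (\<Sum>k<card (verts G). count_list (W k) i)"

text \<open>
  The diameter is an extended real, so the sum over distances from 1 to the diameter runs over
  the natural numbers \<open>k \<ge> 1\<close> below it. A digraph with a spanning factorization is strongly
  connected, so its diameter is finite.
\<close>

definition short_spanning_factorization ::
    "('v, 'e) pre_digraph \<Rightarrow> nat \<Rightarrow> (nat \<Rightarrow> ('v, 'e) pre_digraph) \<Rightarrow> (nat \<Rightarrow> nat list) \<Rightarrow> bool" where
  "short_spanning_factorization G d F W \<longleftrightarrow>
     spanning_factorization G d F W \<and>
     \<lceil>(\<Sum>i = 1..d. real (symbol_occurrences G W i)) / real d\<rceil> =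
     \<lceil>\<Sum>k\<in>{k. 1 \<le> k \<and> ereal (real k) \<le> digraph_diameter G}.
        real k * real (num_pairs_at_dist G k) / (real (card (verts G)) * real d)\<rceil>"

definition has_short_spanning_factorization :: "('v, 'e) pre_digraph \<Rightarrow> bool" where
  "has_short_spanning_factorization G \<longleftrightarrow> (\<exists>d F W. short_spanning_factorization G d F W)"


section \<open>The graphs \<open>H\<^sub>q\<close>\<close>

definition primitive_root :: "'a::field \<Rightarrow> bool" where
  "primitive_root z \<longleftrightarrow> range (\<lambda>k::nat. z ^ k) = UNIV - {0}"

definition even_powers :: "'a::field \<Rightarrow> 'a set" where
  "even_powers z = range (\<lambda>k::nat. z ^ (2 * k))"

text \<open>
  The field \<open>GF(q)\<close> is the type \<open>'a\<close>, and the elements of \<open>\<int>\<^sub>2\<close> are the natural numbers 0 and 1.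
\<close>

definition H_graph :: "'a::{field,finite} \<Rightarrow> ('a \<times> 'a \<times> nat) pair_pre_digraph" where
  "H_graph z =
    \<lparr> pverts = UNIV \<times> UNIV \<times> {0, 1},
      parcs =
        {((i, m, r), (i, m + z ^ r * x, r)) | i m r x. r \<in> {0, 1} \<and> x \<in> even_powers z} \<union>
        {((i, m, r), (j, m + (-1) ^ r * i * j, 1 - r)) | i m r j. r \<in> {0, 1}} \<rparr>"

end

theory Submission
  imports Defs "HOL-Combinatorics.Transposition"
begin

text \<open>
  The vertices have two sides, \<open>r = 0\<close> and \<open>r = 1\<close>. The factors are of two kinds: a \<^emph>\<open>shift\<close>
  \<open>A x\<close> for each even power \<open>x\<close> sends \<open>(i, m, r)\<close> to \<open>(i, m + z ^ r * x, r)\<close>, and a \<^emph>\<open>crossing\<close>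
  \<open>B y\<close> for each field element \<open>y\<close> takes the crossing arc whose new first coordinate is
  \<open>i + (- 1) ^ r * y\<close>. The words are the empty word, all letters, and the two-letter words
  \<open>A (a * x) A (b * x)\<close>, \<open>A x B y\<close>, \<open>B y A x\<close>, and \<open>B y B y'\<close> with \<open>y \<noteq> y'\<close>, where \<open>z = a + b\<close> is
  a fixed decomposition of the nonsquare \<open>z\<close> into two nonzero squares.

  From a vertex \<open>(i, m, r)\<close> these words reach everything:
  \<^item> A vertex \<open>(i, m', r)\<close> differs by \<open>z ^ r * c\<close> in the middle coordinate; \<open>c\<close> is zero, a square
    (one shift), or \<open>z\<close> times a square \<open>x\<close> (the shifts by \<open>a * x\<close> and \<open>b * x\<close>).
  \<^item> A vertex on the other side differs from the endpoint of a crossing by some \<open>c\<close> in the middle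
    coordinate. A shift before the crossing and one after it change that coordinate by elements
    of different square classes, so one of the two orders produces \<open>c\<close> if \<open>c \<noteq> 0\<close>.
  \<^item> A vertex \<open>(i', m', r)\<close> with \<open>i' \<noteq> i\<close> is reached by two crossings through the first coordinate
    \<open>j\<close>, which change the middle coordinate by \<open>\<plusminus> j * (i - i')\<close>; this determines \<open>j\<close>. The sign
    \<open>(- 1) ^ r\<close> in the definition of \<open>B y\<close> makes \<open>B y B y\<close> restore the first coordinate, so
    that \<open>i' \<noteq> i\<close> means exactly \<open>y \<noteq> y'\<close>, whatever the starting vertex.

  There are at most \<open>2 * q ^ 2\<close> words, which is the number of vertices, so the words reach each
  vertex exactly once. Since all letters are words, a two-letter word can end neither at its
  starting vertex nor at an out-neighbour of it, so every word is a shortest path. For a list of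
  shortest words, the number of symbols is \<open>1 / n\<close> times the sum of all distances, and the two
  sides of the condition for being short agree even before rounding up.
\<close>

section \<open>Words as walks\<close>

lemma one_factoring_wf_digraph:
  assumes "one_factoring G d F"
  shows "wf_digraph G"
  using assms by (auto simp: one_factoring_def regular_digraph_def dest: fin_digraph.axioms)

lemma one_factor_out_arcs:
  assumes "one_factor H G" and "v \<in> verts G"
  obtains e where "out_arcs H v = {e}" "e \<in> arcs G" "tail G e = v" "head G e = factor_succ H v"
proof -
  obtain e where e: "out_arcs H v = {e}"
    using assms by (auto simp: one_factor_def out_degree_def card_1_singleton_iff)
  then have "e \<in> arcs H" "tail H e = v"
    by (auto simp: out_arcs_def)
  with e assms(1) show thesis
    by (intro that[of e])
      (auto simp: one_factor_def spanning_def subgraph_def compatible_def factor_succ_def)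
qed

lemma word_end_simps [simp]:
  "word_end F v [] = v"
  "word_end F v (i # w) = word_end F (factor_succ (F i) v) w"
  by (simp_all add: word_end_def)

text \<open>
  The walk is what bounds the distance to the endpoint of a word from above.
\<close>

lemma word_end_awalk:
  assumes "one_factoring G d F" and "v \<in> verts G" and "set w \<subseteq> {1..d}"
  shows "\<exists>p. pre_digraph.awalk G v p (word_end F v w) \<and> length p = length w"
proof -
  interpret wf_digraph G
    using assms(1) by (rule one_factoring_wf_digraph)
  show ?thesis
    using assms(2,3)
  proof (induction w arbitrary: v)
    case Nil
    then show ?case by (intro exI[of _ "[]"]) (simp add: awalk_Nil_iff)
  next
    case (Cons i w)
    have "one_factor (F i) G"
      using assms(1) Cons.prems by (simp add: one_factoring_def)
    then obtain e where e: "e \<in> arcs G" "tail G e = v" "head G e = factor_succ (F i) v"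
      using Cons.prems(1) by (rule one_factor_out_arcs)
    then have "factor_succ (F i) v \<in> verts G"
      using head_in_verts by metis
    then obtain p where "awalk (factor_succ (F i) v) p (word_end F (factor_succ (F i) v) w)"
      "length p = length w"
      using Cons by auto
    with e show ?case
      by (intro exI[of _ "e # p"]) (simp add: awalk_Cons_iff)
  qed
qed

lemma word_end_in_verts:
  assumes "one_factoring G d F" and "v \<in> verts G" and "set w \<subseteq> {1..d}"
  shows "word_end F v w \<in> verts G"
  using word_end_awalk[OF assms] wf_digraph.awalk_last_in_verts[OF one_factoring_wf_digraph[OF assms(1)]]
  by blast

lemma arc_is_one_letter_word:
  assumes "one_factoring G d F" and "e \<in> arcs G"
  obtains i where "i \<in> {1..d}" "factor_succ (F i) (tail G e) = head G e"
proof -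
  interpret wf_digraph G
    using assms(1) by (rule one_factoring_wf_digraph)
  obtain i where i: "i \<in> {1..d}" "e \<in> arcs (F i)"
    using assms unfolding one_factoring_def by blast
  have F: "one_factor (F i) G"
    using assms(1) i by (simp add: one_factoring_def)
  obtain e' where e': "out_arcs (F i) (tail G e) = {e'}" "head G e' = factor_succ (F i) (tail G e)"
    using one_factor_out_arcs[OF F tail_in_verts[OF assms(2)]] by metis
  have "e \<in> out_arcs (F i) (tail G e)"
    using i F by (auto simp: out_arcs_def one_factor_def spanning_def subgraph_def compatible_def)
  with e' i show thesis by (intro that[of i]) auto
qed

section \<open>Distances\<close>

lemma (in wf_digraph) awalk_cost_one: "awalk_cost (\<lambda>_. 1) p = real (length p)"
  by (induction p) auto

lemma (in wf_digraph) directed_dist_le_length: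
  assumes "awalk u p v"
  shows "directed_dist G u v \<le> ereal (real (length p))"
  using assms by (auto simp: directed_dist_def \<mu>_def awalk_cost_one intro!: INF_lower2)

lemma (in wf_digraph) directed_dist_ge:
  assumes "\<And>p. awalk u p v \<Longrightarrow> n \<le> length p"
  shows "ereal (real n) \<le> directed_dist G u v"
  using assms by (auto simp: directed_dist_def \<mu>_def awalk_cost_one intro!: INF_greatest)

text \<open>
  A spanning factorization has as many words as vertices, so distinct endpoints are all vertices.
\<close>

lemma word_ends_bij_betw:
  assumes "spanning_factorization G d F W" and "v \<in> verts G"
  shows "bij_betw (\<lambda>k. word_end F v (W k)) {..<card (verts G)} (verts G)"
proof -
  let ?e = "\<lambda>k. word_end F v (W k)"
  have F: "one_factoring G d F" and inj: "inj_on ?e {..<card (verts G)}"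
    and W: "\<And>k. k < card (verts G) \<Longrightarrow> set (W k) \<subseteq> {1..d}"
    using assms by (simp_all add: spanning_factorization_def)
  interpret fin_digraph G
    using F by (simp add: one_factoring_def regular_digraph_def)
  have "?e ` {..<card (verts G)} = verts G"
    using word_end_in_verts[OF F assms(2)] W card_image[OF inj]
    by (intro card_subset_eq) auto
  with inj show ?thesis by (simp add: bij_betw_def)
qed

text \<open>
  The word list contributes one pair per starting vertex and word, and the distance in this pair
  is the length of the word.
\<close>

lemma num_pairs_at_dist_geodesic:
  assumes sf: "spanning_factorization G d F W"
    and geo: "\<And>v k. v \<in> verts G \<Longrightarrow> k < card (verts G) \<Longrightarrow>
      directed_dist G v (word_end F v (W k)) = ereal (real (length (W k)))"
  shows "num_pairs_at_dist G m =
    card (verts G) * card {k \<in> {..<card (verts G)}. length (W k) = m}"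
proof -
  let ?n = "card (verts G)"
  let ?K = "{k \<in> {..<?n}. length (W k) = m}"
  let ?f = "\<lambda>(v, k). (v, word_end F v (W k))"
  have "inj_on (\<lambda>k. word_end F v (W k)) {..<?n}" if "v \<in> verts G" for v
    using word_ends_bij_betw[OF sf that] by (rule bij_betw_imp_inj_on)
  then have inj: "inj_on ?f (verts G \<times> ?K)"
    by (auto simp: inj_on_def)
  have "{(u, w). u \<in> verts G \<and> w \<in> verts G \<and> directed_dist G u w = ereal (real m)} =
      ?f ` (verts G \<times> ?K)" (is "?A = ?B")
  proof (rule subset_antisym; rule subsetI)
    fix x assume "x \<in> ?A"
    then obtain u w where x: "x = (u, w)" "u \<in> verts G" "w \<in> verts G"
      "directed_dist G u w = ereal (real m)"
      by blast
    then have "w \<in> (\<lambda>k. word_end F u (W k)) ` {..<?n}"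
      using word_ends_bij_betw[OF sf x(2)] by (simp add: bij_betw_def)
    then obtain k where "k < ?n" "w = word_end F u (W k)"
      by blast
    with x geo[of u k] show "x \<in> ?B"
      by (auto intro!: image_eqI[of _ _ "(u, k)"])
  next
    fix x assume "x \<in> ?B"
    then obtain u k where x: "x = (u, word_end F u (W k))" "u \<in> verts G" "k < ?n" "length (W k) = m"
      by auto
    then have "word_end F u (W k) \<in> verts G"
      using word_ends_bij_betw[OF sf x(2)] by (auto simp: bij_betw_def)
    with x geo[of u k] show "x \<in> ?A"
      by auto
  qed
  then show ?thesis
    using card_image[OF inj] by (simp add: num_pairs_at_dist_def card_cartesian_product)
qed

lemma sum_symbol_occurrences:
  assumes "\<And>k. k < card (verts G) \<Longrightarrow> set (W k) \<subseteq> {1..d}"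
  shows "(\<Sum>i = 1..d. symbol_occurrences G W i) = (\<Sum>k<card (verts G). length (W k))"
proof -
  have "(\<Sum>i = 1..d. symbol_occurrences G W i)
      = (\<Sum>k<card (verts G). \<Sum>i = 1..d. count_list (W k) i)"
    unfolding symbol_occurrences_def by (rule sum.swap)
  also have "\<dots> = (\<Sum>k<card (verts G). length (W k))"
    using assms by (intro sum.cong sum_count_set) auto
  finally show ?thesis .
qed

text \<open>
  Counting the symbols word by word gives the total length of the words; counting the
  distances from any one vertex gives the same total. Dividing both by \<open>d\<close> gives two equal
  numbers before rounding.
\<close>

theorem short_if_words_geodesic:
  assumes sf: "spanning_factorization G d F W"
    and geo: "\<And>v k. v \<in> verts G \<Longrightarrow> k < card (verts G) \<Longrightarrow>
      directed_dist G v (word_end F v (W k)) = ereal (real (length (W k)))"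
  shows "short_spanning_factorization G d F W"
proof -
  define n where "n = card (verts G)"
  define K where "K = {k. 1 \<le> k \<and> ereal (real k) \<le> digraph_diameter G}"
  have W: "set (W k) \<subseteq> {1..d}" if "k < n" for k
    using sf that by (simp add: spanning_factorization_def n_def)
  have occ: "(\<Sum>i = 1..d. real (symbol_occurrences G W i)) = (\<Sum>k<n. real (length (W k)))"
    using sum_symbol_occurrences[of G W d] W
    by (simp add: n_def flip: of_nat_sum)
  have K_ge: "length (W k) \<in> insert 0 K" if "k < n" for k
  proof -
    from that obtain v where v: "v \<in> verts G"
      by (cases "verts G = {}") (auto simp: n_def)
    have "word_end F v (W k) \<in> verts G"
      using word_ends_bij_betw[OF sf v] that by (auto simp: bij_betw_def n_def)
    then have "directed_dist G v (word_end F v (W k)) \<le> digraph_diameter G"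
      unfolding digraph_diameter_def using v by (intro SUP_upper2[OF v] SUP_upper)
    with geo[OF v] that show ?thesis
      by (auto simp: K_def n_def Suc_le_eq)
  qed
  (* The sum over K is a finite sum only because the diameter is finite; any finite bound does. *)
  have "digraph_diameter G \<le> ereal (real (\<Sum>k<n. length (W k)))"
    unfolding digraph_diameter_def
  proof (intro SUP_least)
    fix u w assume u: "u \<in> verts G" and "w \<in> verts G"
    then have "w \<in> (\<lambda>k. word_end F u (W k)) ` {..<n}"
      using word_ends_bij_betw[OF sf u] by (simp add: bij_betw_def n_def)
    then obtain k where k: "k < n" "w = word_end F u (W k)"
      by blast
    then have "length (W k) \<le> (\<Sum>k<n. length (W k))"
      by (intro member_le_sum) auto
    with k geo[OF u, of k] show "directed_dist G u w \<le> ereal (real (\<Sum>k<n. length (W k)))"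
      by (simp add: n_def del: of_nat_sum)
  qed
  then have "ereal (real m) \<le> ereal (real (\<Sum>k<n. length (W k)))" if "m \<in> K" for m
    using that unfolding K_def by (blast intro: order_trans)
  then have "K \<subseteq> {..(\<Sum>k<n. length (W k))}"
    by (auto simp del: of_nat_sum)
  then have fin: "finite K"
    by (rule finite_subset) simp
  have pairs: "num_pairs_at_dist G m = n * card {k \<in> {..<n}. length (W k) = m}" for m
    unfolding n_def by (rule num_pairs_at_dist_geodesic[OF sf geo])
  have "(\<Sum>m\<in>K. real m * real (num_pairs_at_dist G m) / (real n * real d))
      = (\<Sum>m\<in>K. real m * real (card {k \<in> {..<n}. length (W k) = m})) / real d"
    unfolding sum_divide_distrib
    by (intro sum.cong) (auto simp: pairs)
  also have "(\<Sum>m\<in>K. real m * real (card {k \<in> {..<n}. length (W k) = m}))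
      = (\<Sum>m\<in>K. \<Sum>k<n. if length (W k) = m then real m else 0)"
    by (intro sum.cong) (auto simp: sum.If_cases Int_def)
  also have "\<dots> = (\<Sum>k<n. \<Sum>m\<in>K. if length (W k) = m then real m else 0)"
    by (rule sum.swap)
  also have "\<dots> = (\<Sum>k<n. real (length (W k)))"
    using K_ge fin by (intro sum.cong) auto
  finally show ?thesis
    using sf occ by (simp add: short_spanning_factorization_def n_def K_def)
qed

text \<open>
  If a two-letter word ended at a vertex at distance at most 1, the empty word or one of the
  one-letter words would end there too, and endpoints would not be distinct.
\<close>

theorem short_if_words_length_le_2:
  assumes sf: "spanning_factorization G d F W"
    and len: "\<And>k. k < card (verts G) \<Longrightarrow> length (W k) \<le> 2"
    and letters: "\<And>i. i \<in> {1..d} \<Longrightarrow> \<exists>k<card (verts G). W k = [i]"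
  shows "short_spanning_factorization G d F W"
proof (rule short_if_words_geodesic[OF sf])
  fix v k
  assume v: "v \<in> verts G" and k: "k < card (verts G)"
  define w where "w = word_end F v (W k)"
  have F: "one_factoring G d F" and W: "set (W k) \<subseteq> {1..d}" and W0: "W 0 = []"
    using sf k by (simp_all add: spanning_factorization_def)
  interpret wf_digraph G
    using F by (rule one_factoring_wf_digraph)
  have same: "W k' = W k" if "k' < card (verts G)" "word_end F v (W k') = w" for k'
    using word_ends_bij_betw[OF sf v] that k by (auto simp: bij_betw_def inj_on_def w_def)
  have "length (W k) \<le> length p" if p: "awalk v p w" for p
  proof (cases "length p \<ge> 2")
    case True
    then show ?thesis using len[OF k] by simp
  next
    case False
    then consider "p = []" | e where "p = [e]"
      by (cases p; cases "tl p") auto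
    then show ?thesis
    proof cases
      case 1
      then have "w = v" using p by (simp add: awalk_Nil_iff)
      then have "W 0 = W k" using k W0 by (intro same) auto
      then show ?thesis using W0 by simp
    next
      case 2
      then have e: "e \<in> arcs G" "tail G e = v" "head G e = w"
        using p by (auto simp: awalk_Cons_iff awalk_Nil_iff)
      then obtain i where i: "i \<in> {1..d}" "factor_succ (F i) v = w"
        using arc_is_one_letter_word[OF F e(1)] by metis
      then obtain k' where "k' < card (verts G)" "W k' = [i]"
        using letters by blast
      with i same[of k'] have "W k = [i]" by auto
      then show ?thesis using 2 by simp
    qed
  qed
  then have "ereal (real (length (W k))) \<le> directed_dist G v w"
    by (rule directed_dist_ge)
  moreover obtain p where "awalk v p w" "length p = length (W k)"
    using word_end_awalk[OF F v W] by (auto simp: w_def)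
  then have "directed_dist G v w \<le> ereal (real (length (W k)))"
    using directed_dist_le_length by metis
  ultimately show "directed_dist G v (word_end F v (W k)) = ereal (real (length (W k)))"
    by (simp add: w_def)
qed


section \<open>Factorizations given by permutations of the vertices\<close>

definition permutation_factor :: "'v set \<Rightarrow> ('v \<Rightarrow> 'v) \<Rightarrow> ('v, 'v \<times> 'v) pre_digraph" where
  "permutation_factor V f = \<lparr> verts = V, arcs = (\<lambda>v. (v, f v)) ` V, tail = fst, head = snd \<rparr>"

lemma permutation_factor_simps [simp]:
  "verts (permutation_factor V f) = V"
  "arcs (permutation_factor V f) = (\<lambda>v. (v, f v)) ` V"
  "tail (permutation_factor V f) = fst"
  "head (permutation_factor V f) = snd"
  by (simp_all add: permutation_factor_def)

lemma out_arcs_permutation_factor: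
  "v \<in> V \<Longrightarrow> out_arcs (permutation_factor V f) v = {(v, f v)}"
  by (auto simp: out_arcs_def)

lemma factor_succ_permutation_factor:
  "v \<in> V \<Longrightarrow> factor_succ (permutation_factor V f) v = f v"
  by (simp add: factor_succ_def out_arcs_permutation_factor)

lemma in_arcs_permutation_factor:
  assumes "bij_betw f V V" and "v \<in> V"
  shows "in_arcs (permutation_factor V f) v = {(inv_into V f v, v)}"
proof -
  have g: "inv_into V f v \<in> V" "f (inv_into V f v) = v"
    using bij_betw_apply[OF bij_betw_inv_into[OF assms(1)] assms(2)]
      bij_betw_inv_into_right[OF assms] .
  have "u = inv_into V f v" if "u \<in> V" "f u = v" for u
    using bij_betw_inv_into_left[OF assms(1) that(1)] that(2) by simp
  with g have "{u \<in> V. f u = v} = {inv_into V f v}"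
    by blast
  moreover have "in_arcs (permutation_factor V f) v = (\<lambda>u. (u, f u)) ` {u \<in> V. f u = v}"
    by (auto simp: in_arcs_def)
  ultimately show ?thesis
    using g(2) by simp
qed

lemma one_factor_permutation_factor:
  assumes "bij_betw f V V" and "wf_digraph G" and "verts G = V" and "tail G = fst" "head G = snd"
    and "(\<lambda>v. (v, f v)) ` V \<subseteq> arcs G"
  shows "one_factor (permutation_factor V f) G"
proof -
  have "wf_digraph (permutation_factor V f)"
    using bij_betw_apply[OF assms(1)] by unfold_locales auto
  then show ?thesis
    using assms
    by (auto simp: one_factor_def spanning_def subgraph_def compatible_def in_degree_def
        out_degree_def out_arcs_permutation_factor in_arcs_permutation_factor)
qed

text \<open>
  The degree \<open>d\<close> comes out of the factors: the out-arcs at \<open>v\<close> are indexed by the images of \<open>v\<close>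
  and the in-arcs by its preimages. Two factors that agree on a preimage of \<open>v\<close> share an arc, so
  the preimages are distinct as well.
\<close>

lemma one_factoring_permutation_factors:
  fixes P :: "'v pair_pre_digraph"
  assumes fin: "finite (pverts P)"
    and bij: "\<And>i. i \<in> {1..d} \<Longrightarrow> bij_betw (f i) (pverts P) (pverts P)"
    and arcs: "parcs P = {(v, f i v) | v i. v \<in> pverts P \<and> i \<in> {1..d}}"
    and inj: "\<And>v. v \<in> pverts P \<Longrightarrow> inj_on (\<lambda>i. f i v) {1..d}"
  shows "one_factoring (with_proj P) d (\<lambda>i. permutation_factor (pverts P) (f i))"
proof -
  let ?V = "pverts P" and ?g = "\<lambda>i. inv_into (pverts P) (f i)"
  have f: "f i v \<in> ?V" if "i \<in> {1..d}" "v \<in> ?V" for i v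
    using bij[OF that(1)] that(2) by (rule bij_betw_apply)
  have g: "?g i v \<in> ?V" "f i (?g i v) = v" "?g i (f i v) = v"
    if "i \<in> {1..d}" "v \<in> ?V" for i v
    using bij_betw_apply[OF bij_betw_inv_into[OF bij[OF that(1)]] that(2)]
      bij_betw_inv_into_right[OF bij[OF that(1)] that(2)]
      bij_betw_inv_into_left[OF bij[OF that(1)] that(2)] .
  have "parcs P = (\<lambda>(v, i). (v, f i v)) ` (?V \<times> {1..d})"
    using arcs by auto
  then have "finite (parcs P)"
    using fin by simp
  then have fd: "fin_digraph (with_proj P)"
    using fin arcs f by unfold_locales auto
  have out: "out_arcs (with_proj P) v = (\<lambda>i. (v, f i v)) ` {1..d}" if "v \<in> ?V" for v
    using that arcs by (auto simp: out_arcs_def)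
  have inn: "in_arcs (with_proj P) v = (\<lambda>i. (?g i v, v)) ` {1..d}" if "v \<in> ?V" for v
  proof (rule subset_antisym; rule subsetI)
    fix e assume "e \<in> in_arcs (with_proj P) v"
    then obtain u i where "e = (u, v)" "u \<in> ?V" "i \<in> {1..d}" "f i u = v"
      unfolding in_arcs_def with_proj_simps arcs by auto
    with g(3)[of i u] show "e \<in> (\<lambda>i. (?g i v, v)) ` {1..d}"
      by (intro image_eqI[of _ _ i]) simp_all
  next
    fix e assume "e \<in> (\<lambda>i. (?g i v, v)) ` {1..d}"
    then obtain i where i: "i \<in> {1..d}" "e = (?g i v, v)"
      by blast
    have "(?g i v, f i (?g i v)) \<in> parcs P"
      unfolding arcs using g(1)[OF i(1) that] i(1) by blast
    then show "e \<in> in_arcs (with_proj P) v"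
      using g(2)[OF i(1) that] i(2) by (simp add: in_arcs_def)
  qed
  have "inj_on (\<lambda>i. (v, f i v)) {1..d}" if "v \<in> ?V" for v
    using inj[OF that] unfolding inj_on_def by blast
  moreover have "inj_on (\<lambda>i. (?g i v, v)) {1..d}" if "v \<in> ?V" for v
  proof (rule inj_onI)
    fix i j assume ij: "i \<in> {1..d}" "j \<in> {1..d}" and "(?g i v, v) = (?g j v, v)"
    then have "f i (?g i v) = f j (?g i v)"
      using g(2)[OF ij(1) that] g(2)[OF ij(2) that] by simp
    then show "i = j"
      using inj_onD[OF inj[OF g(1)[OF ij(1) that]]] ij by blast
  qed
  ultimately have "regular_digraph (with_proj P) d"
    using fd by (simp add: regular_digraph_def in_degree_def out_degree_def out inn card_image)
  moreover have "one_factor (permutation_factor ?V (f i)) (with_proj P)" if "i \<in> {1..d}" for i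
  proof (rule one_factor_permutation_factor[OF bij[OF that]])
    show "wf_digraph (with_proj P)"
      using fd by (rule fin_digraph.axioms)
    show "(\<lambda>v. (v, f i v)) ` ?V \<subseteq> arcs (with_proj P)"
      using that unfolding arcs with_proj_simps by blast
  qed simp_all
  moreover have "disjoint_family_on (\<lambda>i. (\<lambda>v. (v, f i v)) ` ?V) {1..d}"
    using inj unfolding disjoint_family_on_def inj_on_def by blast
  moreover have "(\<Union>i\<in>{1..d}. (\<lambda>v. (v, f i v)) ` ?V) = parcs P"
    unfolding arcs by auto
  ultimately show ?thesis
    by (simp add: one_factoring_def)
qed

text \<open>
  It is convenient to describe factors by letters from an arbitrary finite set, and words as a set
  of lists of letters, instead of numbering both. The letters give disjoint factors because the
  one-letter words are among those whose endpoints are distinct.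
\<close>

theorem has_short_spanning_factorization_letters:
  fixes P :: "'v pair_pre_digraph" and step :: "'v \<Rightarrow> 'l \<Rightarrow> 'v"
  assumes fin: "finite (pverts P)" "finite L" and nonempty: "pverts P \<noteq> {}"
    and bij: "\<And>l. l \<in> L \<Longrightarrow> bij_betw (\<lambda>v. step v l) (pverts P) (pverts P)"
    and arcs: "parcs P = {(v, step v l) | v l. v \<in> pverts P \<and> l \<in> L}"
    and S: "S \<subseteq> lists L" "[] \<in> S" "\<And>l. l \<in> L \<Longrightarrow> [l] \<in> S" "\<And>w. w \<in> S \<Longrightarrow> length w \<le> 2"
    and spans: "\<And>v. v \<in> pverts P \<Longrightarrow> bij_betw (foldl step v) S (pverts P)"
  shows "has_short_spanning_factorization (with_proj P)"
proof -
  let ?V = "pverts P"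
  define d n where "d = card L" and "n = card ?V"
  obtain e where e: "bij_betw e {1..d} L"
    using ex_bij_betw_nat_finite_1[OF fin(2)] by (auto simp: d_def)
  obtain v0 where "v0 \<in> ?V" using nonempty by blast
  then have v0: "bij_betw (foldl step v0) S ?V" by (rule spans)
  then have "card S = n" "finite S"
    using fin(1) bij_betw_same_card[OF v0] bij_betw_finite[OF v0] by (simp_all add: n_def)
  then obtain h0 where h0: "bij_betw h0 {..<n} S"
    using ex_bij_betw_nat_finite[of S] by (auto simp: atLeast0LessThan)
  then obtain k0 where k0: "k0 < n" "h0 k0 = []"
    using S(2) by (auto simp: bij_betw_def)
  (* The numbering has to start with the empty word. *)
  define h where "h = h0 \<circ> transpose 0 k0"
  have "bij_betw (transpose 0 k0) {..<n} {..<n}"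
    using k0 by (intro bij_betw_byWitness[where f' = "transpose 0 k0"]) (auto simp: transpose_def)
  then have h: "bij_betw h {..<n} S"
    unfolding h_def using h0 by (rule bij_betw_trans)
  have hS: "h k \<in> S" if "k < n" for k
    using h that by (auto simp: bij_betw_def)
  define F where "F = (\<lambda>i. permutation_factor ?V (\<lambda>v. step v (e i)))"
  define W where "W = (\<lambda>k. map (inv_into {1..d} e) (h k))"
  have eL: "e i \<in> L" if "i \<in> {1..d}" for i
    using e that by (auto simp: bij_betw_def)
  have inv: "inv_into {1..d} e l \<in> {1..d}" "e (inv_into {1..d} e l) = l" if "l \<in> L" for l
    using bij_betw_apply[OF bij_betw_inv_into[OF e] that] bij_betw_inv_into_right[OF e that] .
  have end_map: "word_end F v (map (inv_into {1..d} e) w) = foldl step v w"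
    if "v \<in> ?V" "w \<in> lists L" for v w
    using that
  proof (induction w arbitrary: v)
    case (Cons l w)
    then have "step v l \<in> ?V"
      using bij[of l] by (auto simp: bij_betw_def)
    moreover have "factor_succ (F (inv_into {1..d} e l)) v = step v l"
      using Cons.prems inv(2)[of l] by (simp add: F_def factor_succ_permutation_factor)
    ultimately show ?case
      using Cons.IH[of "step v l"] Cons.prems by simp
  qed simp
  have "inj_on (\<lambda>i. step v (e i)) {1..d}" if v: "v \<in> ?V" for v
  proof (rule inj_onI)
    fix i j assume ij: "i \<in> {1..d}" "j \<in> {1..d}" and "step v (e i) = step v (e j)"
    then have "foldl step v [e i] = foldl step v [e j]" by simp
    then have "[e i] = [e j]"
      by (rule inj_onD[OF bij_betw_imp_inj_on[OF spans[OF v]]]) (use S(3)[OF eL] ij in simp_all)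
    then show "i = j"
      using inj_onD[OF bij_betw_imp_inj_on[OF e]] ij by blast
  qed
  moreover have "parcs P = {(v, step v (e i)) | v i. v \<in> ?V \<and> i \<in> {1..d}}"
  proof -
    have "L = e ` {1..d}"
      using e by (simp add: bij_betw_def)
    then show ?thesis unfolding arcs by blast
  qed
  ultimately have F: "one_factoring (with_proj P) d F"
    unfolding F_def using fin bij eL by (intro one_factoring_permutation_factors) auto
  have W_end: "word_end F v (W k) = foldl step v (h k)" if "v \<in> ?V" "k < n" for v k
    using end_map[of v "h k"] hS[of k] S(1) that by (auto simp: W_def)
  have "inj_on (\<lambda>k. word_end F v (W k)) {..<n}" if v: "v \<in> ?V" for v
  proof -
    have "inj_on (foldl step v \<circ> h) {..<n}"
      using h spans[OF v] by (auto simp: bij_betw_def intro: comp_inj_on)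
    then show ?thesis
      using W_end[OF v] by (simp add: inj_on_def)
  qed
  moreover have "set (W k) \<subseteq> {1..d}" if "k < n" for k
    using hS[OF that] S(1) inv(1) by (force simp: W_def)
  moreover have "W 0 = []"
    using k0 by (simp add: W_def h_def)
  ultimately have "spanning_factorization (with_proj P) d F W"
    using F by (simp add: spanning_factorization_def n_def)
  moreover have "length (W k) \<le> 2" if "k < n" for k
    using S(4)[OF hS[OF that]] by (simp add: W_def)
  moreover have "\<exists>k<n. W k = [i]" if i: "i \<in> {1..d}" for i
  proof -
    obtain k where "k < n" "h k = [e i]"
      using h S(3)[OF eL[OF i]] by (auto simp: bij_betw_def)
    moreover have "inv_into {1..d} e (e i) = i"
      using bij_betw_inv_into_left[OF e i] .
    ultimately show ?thesis by (intro exI[of _ k]) (simp add: W_def)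
  qed
  ultimately have "short_spanning_factorization (with_proj P) d F W"
    by (intro short_if_words_length_le_2) (simp_all add: n_def)
  then show ?thesis
    unfolding has_short_spanning_factorization_def by blast
qed

section \<open>Even powers of a primitive root\<close>

context
  fixes z :: "'a::{field,finite}"
  assumes z: "primitive_root z"
begin

lemma primitive_root_nonzero: "z \<noteq> 0"
proof -
  have "z ^ 1 \<in> UNIV - {0}"
    using z unfolding primitive_root_def by blast
  then show ?thesis by simp
qed

text \<open>
  Multiplication by \<open>z\<close> permutes the nonzero elements, so it does not change their product.
\<close>

lemma primitive_root_power_card: "z ^ (CARD('a) - 1) = 1"
proof -
  let ?U = "UNIV - {0 :: 'a}"
  have "bij_betw ((*) z) ?U ?U"
    using primitive_root_nonzero
    by (intro bij_betw_byWitness[where f' = "\<lambda>x. x / z"]) auto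
  then have "(\<Prod>x\<in>?U. z * x) = \<Prod>?U"
    by (rule prod.reindex_bij_betw)
  then have "z ^ card ?U * \<Prod>?U = \<Prod>?U"
    by (simp add: prod.distrib)
  moreover have "\<Prod>?U \<noteq> 0"
    by simp
  ultimately show ?thesis
    by (simp add: card_Diff_singleton)
qed

lemma even_powers_nonzero: "x \<in> even_powers z \<Longrightarrow> x \<noteq> 0"
  using primitive_root_nonzero by (auto simp: even_powers_def)

lemma even_powers_mult: "x \<in> even_powers z \<Longrightarrow> y \<in> even_powers z \<Longrightarrow> x * y \<in> even_powers z"
proof -
  assume "x \<in> even_powers z" "y \<in> even_powers z"
  then obtain k l where "x = z ^ (2 * k)" "y = z ^ (2 * l)"
    by (auto simp: even_powers_def)
  then have "x * y = z ^ (2 * (k + l))"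
    by (simp add: power_add distrib_left)
  then show ?thesis
    unfolding even_powers_def by blast
qed

lemma nonzero_cases:
  assumes "c \<noteq> 0"
  obtains "c \<in> even_powers z" | x where "x \<in> even_powers z" "c = z * x"
proof -
  obtain k where "c = z ^ k"
    using z assms by (auto simp: primitive_root_def)
  have even: "z ^ (2 * l) \<in> even_powers z" for l
    by (simp add: even_powers_def)
  show thesis
  proof (cases "even k")
    case True
    then obtain l where "k = 2 * l" by (rule evenE)
    with even[of l] show thesis using \<open>c = z ^ k\<close> that(1) by simp
  next
    case False
    then obtain l where "k = 2 * l + 1" by (rule oddE)
    with even[of l] show thesis using \<open>c = z ^ k\<close> that(2) by simp
  qed
qed

text \<open>
  The exponents of even powers matter only modulo the even number \<open>q - 1\<close>, which gives at most
  \<open>(q - 1) / 2\<close> of them. They cannot be fewer, since they and their multiples by \<open>z\<close> are all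
  nonzero elements.
\<close>

lemma card_even_powers:
  assumes "odd (CARD('a))"
  shows "CARD('a) = 2 * card (even_powers z) + 1"
proof -
  obtain h where h: "CARD('a) = 2 * h + 1"
    using assms by (auto elim: oddE)
  have "card {0, 1 :: 'a} \<le> CARD('a)"
    by (rule card_mono) auto
  with h have "h > 0" by simp
  have pow: "z ^ (2 * h) = 1"
    using primitive_root_power_card h by simp
  have "even_powers z \<subseteq> (\<lambda>k. z ^ (2 * k)) ` {..<h}"
  proof
    fix x assume "x \<in> even_powers z"
    then obtain k where "x = z ^ (2 * k)"
      by (auto simp: even_powers_def)
    also have "2 * k = 2 * h * (k div h) + 2 * (k mod h)"
      using mult_div_mod_eq[of h k] by (metis distrib_left mult.assoc)
    also have "z ^ \<dots> = z ^ (2 * (k mod h))"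
      by (simp only: power_add power_mult[of z "2 * h"] pow power_one mult_1)
    finally show "x \<in> (\<lambda>k. z ^ (2 * k)) ` {..<h}"
      using \<open>h > 0\<close> by auto
  qed
  then have "card (even_powers z) \<le> h"
    by (metis card_lessThan finite_lessThan surj_card_le)
  have "UNIV \<subseteq> {0} \<union> even_powers z \<union> (*) z ` even_powers z"
    using nonzero_cases by auto
  then have "CARD('a) \<le> card ({0} \<union> even_powers z \<union> (*) z ` even_powers z)"
    by (intro card_mono) auto
  also have "card ({0} \<union> even_powers z \<union> (*) z ` even_powers z)
      \<le> 1 + card (even_powers z) + card ((*) z ` even_powers z)"
    using card_Un_le[of "{0} \<union> even_powers z" "(*) z ` even_powers z"]
      card_Un_le[of "{0}" "even_powers z"] by simp
  finally have "CARD('a) \<le> 1 + card (even_powers z) + card ((*) z ` even_powers z)" .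
  moreover have "card ((*) z ` even_powers z) \<le> card (even_powers z)"
    by (rule card_image_le) simp
  ultimately show ?thesis using h \<open>card (even_powers z) \<le> h\<close> by simp
qed

lemma primitive_root_not_even_power:
  assumes "odd (CARD('a))"
  shows "z \<notin> even_powers z"
proof
  assume "z \<in> even_powers z"
  then have "UNIV - {0} \<subseteq> even_powers z"
    using nonzero_cases even_powers_mult by blast
  then have "CARD('a) - 1 \<le> card (even_powers z)"
    by (metis card_mono finite_class.finite_UNIV finite_subset subset_UNIV card_Diff_singleton UNIV_I)
  moreover have "even_powers z \<noteq> {}"
    by (auto simp: even_powers_def)
  then have "card (even_powers z) > 0"
    by (simp add: card_gt_0_iff)
  ultimately show False
    using card_even_powers[OF assms] by simp
qed

text \<open>
  The set \<open>Y\<close> of squares, with zero, has more than half of all elements, so it meets \<open>z - Y\<close>. Both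
  summands are then nonzero because \<open>z\<close> itself is not a square.
\<close>

lemma primitive_root_sum_of_even_powers:
  assumes "odd (CARD('a))"
  obtains a b where "a \<in> even_powers z" "b \<in> even_powers z" "z = a + b"
proof -
  let ?Y = "insert 0 (even_powers z)"
  have card: "card ?Y = card (even_powers z) + 1"
    using even_powers_nonzero by (subst card_insert_disjoint) auto
  have "?Y \<inter> (\<lambda>a. z - a) ` ?Y \<noteq> {}"
  proof
    assume "?Y \<inter> (\<lambda>a. z - a) ` ?Y = {}"
    then have "card (?Y \<union> (\<lambda>a. z - a) ` ?Y) = card ?Y + card ((\<lambda>a. z - a) ` ?Y)"
      by (intro card_Un_disjoint) auto
    also have "card ((\<lambda>a. z - a) ` ?Y) = card ?Y"
      by (intro card_image) (auto simp: inj_on_def)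
    finally have "2 * card ?Y \<le> CARD('a)"
      using card_mono[of UNIV "?Y \<union> (\<lambda>a. z - a) ` ?Y"] by simp
    then show False
      using card card_even_powers[OF assms] by simp
  qed
  then obtain a b where ab: "a \<in> ?Y" "b \<in> ?Y" "b = z - a"
    by blast
  moreover have "a \<noteq> 0" "b \<noteq> 0"
    using ab primitive_root_not_even_power[OF assms] primitive_root_nonzero by auto
  ultimately show thesis
    by (intro that[of a b]) auto
qed

end

section \<open>The factorization of the graphs\<close>

text \<open>
  A letter \<open>Inl x\<close> is a shift and \<open>Inr y\<close> is a crossing. With the sign in the first coordinate
  \<open>i + (- 1) ^ r * y\<close>, crossing twice with the same \<open>y\<close> restores that coordinate on either side,
  which lets one condition \<open>y \<noteq> y'\<close> serve for both sides.
\<close>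

fun H_step :: "'a::field \<Rightarrow> 'a \<times> 'a \<times> nat \<Rightarrow> 'a + 'a \<Rightarrow> 'a \<times> 'a \<times> nat" where
  "H_step z (i, m, r) (Inl x) = (i, m + z ^ r * x, r)"
| "H_step z (i, m, r) (Inr y) =
    (i + (-1) ^ r * y, m + (-1) ^ r * i * (i + (-1) ^ r * y), 1 - r)"

definition H_letters :: "'a::field \<Rightarrow> ('a + 'a) set" where
  "H_letters z = Inl ` even_powers z \<union> range Inr"

definition H_words :: "'a::field \<Rightarrow> 'a \<Rightarrow> 'a \<Rightarrow> ('a + 'a) list set" where
  "H_words z a b =
     {[]} \<union> (\<lambda>l. [l]) ` H_letters z \<union>
     (\<lambda>x. [Inl (a * x), Inl (b * x)]) ` even_powers z \<union>
     (\<lambda>(x, y). [Inl x, Inr y]) ` (even_powers z \<times> UNIV) \<union>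
     (\<lambda>(x, y). [Inr y, Inl x]) ` (even_powers z \<times> UNIV) \<union>
     (\<lambda>(y, y'). [Inr y, Inr y']) ` (UNIV \<times> UNIV - range (\<lambda>y. (y, y)))"

text \<open>
  With \<open>h = (q - 1) / 2\<close> even powers, the six kinds of words number at most
  \<open>1 + (h + q) + h + h * q + h * q + (q * q - q) = 2 * q ^ 2\<close>. An upper bound suffices, since the
  words reach all vertices.
\<close>

lemma card_H_words_le:
  fixes z :: "'a::{field,finite}"
  assumes "CARD('a) = 2 * card (even_powers z) + 1"
  shows "card (H_words z a b) \<le> 2 * CARD('a) ^ 2"
proof -
  define q h where "q = CARD('a)" and "h = card (even_powers z)"
  have q: "q = 2 * h + 1" using assms by (simp add: q_def h_def)
  let ?D = "UNIV \<times> UNIV - range (\<lambda>y :: 'a. (y, y))"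
  have "card (range (\<lambda>y :: 'a. (y, y))) = q"
    by (simp add: q_def card_image inj_on_def)
  then have "card ?D = q * q - q"
    by (subst card_Diff_subset) (auto simp: q_def card_cartesian_product simp del: UNIV_Times_UNIV)
  then have D: "card (f ` ?D) \<le> q * q - q" for f :: "_ \<Rightarrow> ('a + 'a) list"
    by (intro order_trans[OF card_image_le]) simp_all
  have L: "card (H_letters z) \<le> h + q"
    unfolding H_letters_def q_def h_def
    by (intro order_trans[OF card_Un_le] add_mono card_image_le) auto
  have "card (H_words z a b) \<le> 1 + (h + q) + h + h * q + h * q + (q * q - q)"
    unfolding H_words_def
    apply (intro order_trans[OF card_Un_le] add_mono)
         apply simp
    apply (rule order_trans[OF card_image_le L]; simp)
    apply (rule order_trans[OF card_image_le]; simp add: h_def)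
    apply (rule order_trans[OF card_image_le]; simp add: h_def q_def)
    apply (rule order_trans[OF card_image_le]; simp add: h_def q_def)
    apply (rule D)
    done
  also have "\<dots> = 2 * q ^ 2"
    by (simp add: q power2_eq_square algebra_simps)
  finally show ?thesis by (simp add: q_def)
qed


lemma H_step_bij_betw:
  fixes z :: "'a::{field,finite}"
  shows "bij_betw (\<lambda>v. H_step z v l) (UNIV \<times> UNIV \<times> {0, 1}) (UNIV \<times> UNIV \<times> {0, 1})"
proof -
  let ?V = "UNIV \<times> UNIV \<times> {0, 1} :: ('a \<times> 'a \<times> nat) set"
  have "inj_on (\<lambda>v. H_step z v l) ?V"
    by (cases l) (auto simp: inj_on_def)
  moreover have "(\<lambda>v. H_step z v l) ` ?V \<subseteq> ?V"
    by (cases l) auto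
  ultimately show ?thesis
    by (simp add: bij_betw_def endo_inj_surj)
qed

lemma parcs_H_graph:
  "parcs (H_graph z) = {(v, H_step z v l) | v l. v \<in> pverts (H_graph z) \<and> l \<in> H_letters z}"
proof (rule subset_antisym; rule subsetI)
  fix e assume "e \<in> parcs (H_graph z)"
  then consider i m r x where "r \<in> {0, 1}" "x \<in> even_powers z"
      "e = ((i, m, r), (i, m + z ^ r * x, r))"
    | i m r j where "r \<in> {0, 1}" "e = ((i, m, r), (j, m + (-1) ^ r * i * j, 1 - r))"
    unfolding H_graph_def by auto
  then show "e \<in> {(v, H_step z v l) | v l. v \<in> pverts (H_graph z) \<and> l \<in> H_letters z}"
  proof cases
    case 1
    then have "e = ((i, m, r), H_step z (i, m, r) (Inl x))" "Inl x \<in> H_letters z"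
      by (simp_all add: H_letters_def)
    moreover have "(i, m, r) \<in> pverts (H_graph z)"
      using 1 by (simp add: H_graph_def)
    ultimately show ?thesis by blast
  next
    case 2
    then have "e = ((i, m, r), H_step z (i, m, r) (Inr ((-1) ^ r * (j - i))))"
      by auto
    moreover have "(i, m, r) \<in> pverts (H_graph z)"
      using 2 by (simp add: H_graph_def)
    moreover have "Inr ((-1) ^ r * (j - i)) \<in> H_letters z"
      by (simp add: H_letters_def)
    ultimately show ?thesis by blast
  qed
next
  fix e assume "e \<in> {(v, H_step z v l) | v l. v \<in> pverts (H_graph z) \<and> l \<in> H_letters z}"
  then obtain i m r l where e: "e = ((i, m, r), H_step z (i, m, r) l)"
    and r: "r \<in> {0, 1}" and l: "l \<in> H_letters z"
    by (auto simp: H_graph_def)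
  show "e \<in> parcs (H_graph z)"
  proof (cases l)
    case (Inl x)
    then have "x \<in> even_powers z" using l by (auto simp: H_letters_def)
    with Inl e r show ?thesis unfolding H_graph_def by auto
  next
    case (Inr y)
    with e r show ?thesis unfolding H_graph_def by auto
  qed
qed

text \<open>
  The letters are solved for in three cases: the two vertices agree in side and first coordinate,
  agree in side only, or lie on opposite sides.
\<close>

lemma H_words_reach:
  fixes z :: "'a::{field,finite}"
  assumes z: "primitive_root z" and ab: "z = a + b"
    and r: "r \<in> {0, 1}" and r': "r' \<in> {0, 1}"
  shows "(i', m', r') \<in> foldl (H_step z) (i, m, r) ` H_words z a b"
proof -
  define s :: 'a where "s = (-1) ^ r"
  have s: "s * s = 1" "(-1) ^ (1 - r) = - s"
    using r by (auto simp: s_def)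
  have reach: ?thesis if "w \<in> H_words z a b" "foldl (H_step z) (i, m, r) w = (i', m', r')" for w
    using that by (metis imageI)
  consider "r' = r" "i' = i" | "r' = r" "i' \<noteq> i" | "r' = 1 - r"
    using r r' by auto
  then show ?thesis
  proof cases
    case 1
    define c where "c = (m' - m) / z ^ r"
    have c: "m' = m + z ^ r * c"
      using primitive_root_nonzero[OF z] by (simp add: c_def)
    show ?thesis
    proof (cases "c = 0")
      case True
      then show ?thesis
        using 1 c by (intro reach[of "[]"]) (simp_all add: H_words_def)
    next
      case False
      with z show ?thesis
      proof (cases rule: nonzero_cases)
        case 1
        then show ?thesis
          using \<open>r' = r\<close> \<open>i' = i\<close> c
          by (intro reach[of "[Inl c]"]) (simp_all add: H_words_def H_letters_def)
      next
        case (2 x)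
        then show ?thesis
          using \<open>r' = r\<close> \<open>i' = i\<close> c
          by (intro reach[of "[Inl (a * x), Inl (b * x)]"])
            (auto simp: H_words_def ab algebra_simps)
      qed
    qed
  next
    case 2
    (* Two crossings via j change the middle coordinate by s * j * (i - i'). *)
    define j where "j = s * (m' - m) / (i - i')"
    define y y' where "y = s * (j - i)" and "y' = s * (j - i')"
    have "j * (i - i') = s * (m' - m)"
      using 2 by (simp add: j_def)
    then have "s * (j * (i - i')) = s * s * (m' - m)"
      by simp
    then have m': "m' = m + s * i * j - s * j * i'"
      by (simp add: s algebra_simps)
    have "y \<noteq> y'"
      using 2 s(1) by (auto simp: y_def y'_def)
    have j: "i + s * y = j" and i': "j + - s * y' = i'"
      by (simp_all add: y_def y'_def s flip: mult.assoc)
    show ?thesis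
    proof (rule reach)
      show "[Inr y, Inr y'] \<in> H_words z a b"
        using \<open>y \<noteq> y'\<close> by (auto simp: H_words_def)
      have "H_step z (i, m, r) (Inr y) = (j, m + s * i * j, 1 - r)"
        using j by (simp add: s_def)
      moreover have "H_step z (j, m + s * i * j, 1 - r) (Inr y') = (i', m', r')"
        using i' m' 2 r s(2) by auto
      ultimately show "foldl (H_step z) (i, m, r) [Inr y, Inr y'] = (i', m', r')"
        by (simp only: foldl_Cons foldl_Nil)
    qed
  next
    case 3
    define c where "c = m' - m - s * i * i'"
    define y where "y = s * (i' - i)"
    have c: "m' = m + s * i * i' + c"
      by (simp add: c_def)
    have "i + s * y = i'"
      by (simp add: y_def s flip: mult.assoc)
    then have y: "H_step z (i, n, r) (Inr y) = (i', n + s * i * i', 1 - r)" for n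
      by (simp add: s_def)
    (* Shifts act by squares on side 0 and by nonsquares on side 1, so a shift on the side of the
       start and one on the side of the target cover the two cases for a nonzero c. *)
    have lr: ?thesis if "x \<in> even_powers z" "c = z ^ r * x" for x
      using that c y 3 by (intro reach[of "[Inl x, Inr y]"]) (auto simp: H_words_def)
    have rl: ?thesis if "x \<in> even_powers z" "c = z ^ (1 - r) * x" for x
      using that c y 3 by (intro reach[of "[Inr y, Inl x]"]) (auto simp: H_words_def)
    show ?thesis
    proof (cases "c = 0")
      case True
      then show ?thesis
        using c y 3 by (intro reach[of "[Inr y]"]) (simp_all add: H_words_def H_letters_def s_def)
    next
      case False
      with z show ?thesis
        by (cases rule: nonzero_cases) (use r lr rl in auto)
    qed
  qed
qed

lemma H_words_span:
  fixes z :: "'a::{field,finite}"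
  assumes z: "primitive_root z" and odd: "odd (CARD('a))" and ab: "z = a + b"
    and v: "v \<in> UNIV \<times> UNIV \<times> {0, 1}"
  shows "bij_betw (foldl (H_step z) v) (H_words z a b) (UNIV \<times> UNIV \<times> {0, 1})"
proof -
  let ?V = "UNIV \<times> UNIV \<times> {0, 1} :: ('a \<times> 'a \<times> nat) set"
  have "foldl (H_step z) u w \<in> ?V" if "u \<in> ?V" for u w
    using that
  proof (induction w arbitrary: u)
    case (Cons l w)
    have "H_step z u l \<in> ?V"
      using H_step_bij_betw Cons.prems by (rule bij_betw_apply)
    then show ?case
      unfolding foldl_Cons by (rule Cons.IH)
  qed simp
  moreover have "?V \<subseteq> foldl (H_step z) v ` H_words z a b"
    using v H_words_reach[OF z ab] by auto
  ultimately have surj: "foldl (H_step z) v ` H_words z a b = ?V"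
    using v by blast
  have fin: "finite (H_words z a b)"
    by (auto simp: H_words_def H_letters_def)
  have "card ?V = 2 * CARD('a) ^ 2"
    by (simp add: card_cartesian_product power2_eq_square del: UNIV_Times_UNIV)
  then have "card (H_words z a b) \<le> card (foldl (H_step z) v ` H_words z a b)"
    using card_H_words_le[OF card_even_powers[OF z odd], of a b] surj by simp
  (* All vertices are reached by no more words than vertices, so no two words share an endpoint. *)
  then have "inj_on (foldl (H_step z) v) (H_words z a b)"
    using fin card_image_le[OF fin] by (intro eq_card_imp_inj_on) (auto intro: le_antisym)
  with surj show ?thesis
    by (simp add: bij_betw_def)
qed

theorem theorem17:
  fixes q :: nat and z :: "'a::{field,finite}"
  assumes "primepow q"
    and "[q = 1] (mod 4)"
    and "CARD('a) = q"
    and "primitive_root z"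
  shows "has_short_spanning_factorization (with_proj (H_graph z))"
proof -
  have "[q = 1] (mod 2)"
    using assms(2) by (rule cong_dvd_modulus_nat) simp
  then have odd: "odd (CARD('a))"
    using assms(3) by (simp add: cong_def odd_iff_mod_2_eq_one)
  obtain a b where ab: "a \<in> even_powers z" "b \<in> even_powers z" "z = a + b"
    using primitive_root_sum_of_even_powers[OF assms(4) odd] .
  have V: "pverts (H_graph z) = UNIV \<times> UNIV \<times> {0, 1}"
    by (simp add: H_graph_def)
  show ?thesis
  proof (rule has_short_spanning_factorization_letters)
    show "H_words z a b \<subseteq> lists (H_letters z)"
      using ab even_powers_mult[OF assms(4)] by (auto simp: H_words_def H_letters_def)
    show "bij_betw (foldl (H_step z) v) (H_words z a b) (pverts (H_graph z))"
      if "v \<in> pverts (H_graph z)" for v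
      using that unfolding V by (intro H_words_span assms(4) odd ab(3))
    show "bij_betw (\<lambda>v. H_step z v l) (pverts (H_graph z)) (pverts (H_graph z))" for l
      unfolding V by (rule H_step_bij_betw)
  qed (auto simp: V parcs_H_graph H_words_def)
qed

end
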